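(* Let $\varepsilon>0$ and let $\mathbf{A}$ be a $W\times n$ matrix, where $W=\frac{1}{72^2\varepsilon^2}\log n$. Any sliding window algorithm (with window size $W$, where $\mathbf{A}$ is the matrix of the $W$ most recent rows) that returns a matrix $\mathbf{B}$ such that $\|\mathbf{A}^\top\mathbf{A}-\mathbf{B}^\top\mathbf{B}\|_F\le\varepsilon\|\mathbf{A}\|_F^2$ with probability at least $\frac89$ requires $\Omega\!\left(\frac{n}{\varepsilon^2}\log n\right)$ bits of space.
   Context: Sliding window model: rows $\mathbf{r}_1,\mathbf{r}_2,\ldots\in\mathbb{R}^{1\times n}$ arrive one at a time in a single pass; at the current time $t$ the relevant data is the matrix $\mathbf{A}$ formed by the $W$ most recent rows, and the algorithm must produce its output for that matrix. Space is the number of bits of memory used.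
   Formalization: The bound is proved for all ε up to some absolute constant ε₀ rather than every ε>0 (for ε≥1 the matrix B=0 always works with no space, so the claim fails there); W is rounded up to an integer, with log to base 2. *)

theory Defs
  imports
    "HOL-Probability.Probability_Mass_Function"
    "HOL-Probability.Infinite_Product_Measure"
    "Jordan_Normal_Form.Matrix"
begin

definition frobenius_norm :: "real mat \<Rightarrow> real" where
  "frobenius_norm A = sqrt (\<Sum>i<dim_row A. \<Sum>j<dim_col A. (A $$ (i, j))\<^sup>2)"

text \<open>The random source of an algorithm: an infinite tape of independent fair coin flips.\<close>

definition coin_tape :: "(nat \<Rightarrow> bool) measure" where
  "coin_tape = (\<Pi>\<^sub>M i\<in>UNIV. measure_pmf (bernoulli_pmf (1/2)))"

text \<open>
  A one-pass randomized algorithm, in a non-uniform model that is generous to the algorithm. Its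
  memory is a bit string. Its actions may depend in an arbitrary way on the whole random tape (read
  access to the tape is not charged as space, which covers public as well as private coins), on the
  number of rows that have arrived so far (not charged either, so that fresh coins can be used at
  each step), on the memory, and, for an update, on the arriving row. A lower bound in this model
  holds in particular if the clock and the coins must be paid for.
\<close>

record streaming_algorithm =
  initial_memory :: "(nat \<Rightarrow> bool) \<Rightarrow> bool list"
  update_memory :: "(nat \<Rightarrow> bool) \<Rightarrow> nat \<Rightarrow> bool list \<Rightarrow> real vec \<Rightarrow> bool list"
  output_matrix :: "(nat \<Rightarrow> bool) \<Rightarrow> nat \<Rightarrow> bool list \<Rightarrow> real mat"

text \<open>The memory after the first \<open>t\<close> rows \<open>r 0, \<dots>, r (t - 1)\<close> of the stream \<open>r\<close>.\<close>

primrec memory_at ::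
  "streaming_algorithm \<Rightarrow> (nat \<Rightarrow> bool) \<Rightarrow> (nat \<Rightarrow> real vec) \<Rightarrow> nat \<Rightarrow> bool list" where
  "memory_at alg \<omega> r 0 = initial_memory alg \<omega>"
| "memory_at alg \<omega> r (Suc t) = update_memory alg \<omega> t (memory_at alg \<omega> r t) (r t)"

definition output_at ::
  "streaming_algorithm \<Rightarrow> (nat \<Rightarrow> bool) \<Rightarrow> (nat \<Rightarrow> real vec) \<Rightarrow> nat \<Rightarrow> real mat" where
  "output_at alg \<omega> r t = output_matrix alg \<omega> t (memory_at alg \<omega> r t)"

text \<open>The \<open>W \<times> n\<close> matrix of the \<open>W\<close> most recent rows at time \<open>t\<close>; only used for \<open>t \<ge> W\<close>.\<close>

definition window_matrix :: "nat \<Rightarrow> nat \<Rightarrow> (nat \<Rightarrow> real vec) \<Rightarrow> nat \<Rightarrow> real mat" where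
  "window_matrix n W r t = mat_of_rows n (map r [t - W..<t])"

text \<open>Streams of rows of length \<open>n\<close> with entries in \<open>E\<close>; \<open>E = UNIV\<close> gives all real streams.\<close>

definition row_streams :: "nat \<Rightarrow> real set \<Rightarrow> (nat \<Rightarrow> real vec) set" where
  "row_streams n E = {r. \<forall>t. dim_vec (r t) = n \<and> set\<^sub>v (r t) \<subseteq> E}"

text \<open>
  \<open>B\<close> may have any number of rows. The condition on its number of columns is needed because
  subtraction of matrices takes its dimensions from the second argument.
\<close>

definition covariance_approx :: "real \<Rightarrow> real mat \<Rightarrow> real mat \<Rightarrow> bool" where
  "covariance_approx \<epsilon> A B \<longleftrightarrow>
     dim_col B = dim_col A \<and>
     frobenius_norm (transpose_mat A * A - transpose_mat B * B) \<le> \<epsilon> * (frobenius_norm A)\<^sup>2"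

text \<open>
  The guarantee is for each fixed stream and each fixed time, not simultaneously for all times.
  Non-measurable sets have measure \<open>0\<close>, so the event of success is required to be measurable.
\<close>

definition sliding_window_covariance ::
  "nat \<Rightarrow> nat \<Rightarrow> real set \<Rightarrow> real \<Rightarrow> real \<Rightarrow> streaming_algorithm \<Rightarrow> bool" where
  "sliding_window_covariance n W E \<epsilon> p alg \<longleftrightarrow>
     (\<forall>r \<in> row_streams n E. \<forall>t \<ge> W.
        measure coin_tape
          {\<omega>. covariance_approx \<epsilon> (window_matrix n W r t) (output_at alg \<omega> r t)} \<ge> p)"

definition uses_space ::
  "nat \<Rightarrow> real set \<Rightarrow> streaming_algorithm \<Rightarrow> nat \<Rightarrow> bool" where
  "uses_space n E alg s \<longleftrightarrow>
     (\<forall>r \<in> row_streams n E. \<forall>\<omega> t. length (memory_at alg \<omega> r t) \<le> s)"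

text \<open>
  The set \<open>E\<close> of entries for which a lower bound is claimed. If arbitrary real entries are allowed,
  no finite memory suffices, for reasons of magnitude alone. The lower bound is therefore also
  claimed for algorithms that are only correct (and only space bounded) on streams whose entries are
  integers of absolute value at most \<open>n ^ C\<close>. In that case \<open>1 / \<epsilon>\<^sup>2\<close> must not exceed the order of
  \<open>n\<close>: for much smaller \<open>\<epsilon>\<close>, a histogram of \<open>n \<times> n\<close> covariance matrices needs less space.
\<close>

definition admissible_entries :: "nat \<Rightarrow> real \<Rightarrow> nat \<Rightarrow> real \<Rightarrow> real set \<Rightarrow> bool" where
  "admissible_entries C K n \<epsilon> E \<longleftrightarrow>
     E = UNIV \<or>
     (K / \<epsilon>\<^sup>2 \<le> real n \<and> {real_of_int z | z. \<bar>z\<bar> \<le> int n ^ C} \<subseteq> E)"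

end

(* Stack m = floor (log n) blocks of d ~ 1/epsilon^2 rows. Block b is scaled by 2^(m-1-b), and its
   q-th row is h e_q with h ~ sqrt n, followed by n - d arbitrary bits. When zero rows have pushed
   the blocks before i out of the window, block i dominates what is left: the entry (q, j) of the
   Gram matrix, q < d <= j, is h 4^(m-1-i) times the bit j of row q, up to a third of this from the
   smaller blocks. The Frobenius guarantee therefore lets all but 1/72 of the bits of block i be
   read off by rounding. So the memory after the last block is a lossy encoding of m d (n - d)
   bits, with at most a fraction 1/9 + 1/72 = 1/8 of them in error on average, hence of linear size.
   With unrestricted real entries, the scales 2^i of a single nonzero row already give
   arbitrarily many inputs to be told apart. *)

theory Submission
  imports Defs
begin

unbundle no vec_syntax

section \<open>Fixing the coins by averaging\<close>

text \<open>The expected number of events that occur is at least \<open>p * card I\<close>, and some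
  point does at least as well as the expectation.\<close>

lemma (in prob_space) exists_point_many_events:
  assumes "finite I" "0 < p" and ev: "\<And>i. i \<in> I \<Longrightarrow> p \<le> prob {\<omega>. P i \<omega>}"
  shows "\<exists>\<omega>\<in>space M. p * real (card I) \<le> real (card {i \<in> I. P i \<omega>})"
proof (rule ccontr)
  assume *: "\<not> ?thesis"
  \<comment> \<open>A set outside the sigma-algebra has measure 0, so the positive bound
    \<open>p\<close> forces measurability.\<close>
  have meas: "{\<omega>. P i \<omega>} \<in> events" if "i \<in> I" for i
    using ev[OF that] \<open>0 < p\<close> by (metis measure_notin_sets not_less)
  define f where "f \<omega> = (\<Sum>i\<in>I. indicator {\<omega>. P i \<omega>} \<omega> :: real)" for \<omega>
  have f_card: "f \<omega> = real (card {i \<in> I. P i \<omega>})" for \<omega>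
    using \<open>finite I\<close> by (simp add: f_def indicator_def sum.If_cases Int_def)
  have int: "integrable M f"
    unfolding f_def using meas by (intro Bochner_Integration.integrable_sum) (simp add: emeasure_eq_measure)
  have "expectation f = (\<Sum>i\<in>I. prob {\<omega>. P i \<omega>})"
    unfolding f_def using meas
    by (subst Bochner_Integration.integral_sum) (auto simp: emeasure_eq_measure intro!: sum.cong arg_cong[where f = prob] dest: sets.sets_into_space)
  also have "\<dots> \<ge> p * real (card I)"
    using sum_mono[of I "\<lambda>_. p", OF ev] by (simp add: mult.commute)
  finally have "p * real (card I) \<le> expectation f" .
  moreover have "expectation f < expectation (\<lambda>_. p * real (card I))"
    using * int by (intro integral_less_AE_space) (auto simp: f_card not_le emeasure_space_1)
  ultimately show False by (simp add: prob_space)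
qed

text \<open>The easy half of Yao's principle: one fixed tape turns the algorithm into a
  deterministic one that succeeds on a fraction \<open>p\<close> of any finite family of
  tests.\<close>

lemma exists_coins_many_events:
  assumes "finite I" "0 < p" "\<And>i. i \<in> I \<Longrightarrow> p \<le> measure coin_tape {\<omega>. P i \<omega>}"
  shows "\<exists>\<omega>. p * real (card I) \<le> real (card {i \<in> I. P i \<omega>})"
proof -
  interpret product_prob_space "\<lambda>_::nat. measure_pmf (bernoulli_pmf (1/2))" UNIV
    by unfold_locales
  interpret prob_space coin_tape
    unfolding coin_tape_def by unfold_locales
  show ?thesis using exists_point_many_events[OF assms(1,2), of P] assms(3) by blast
qed

section \<open>Counting memory states\<close>

lemma card_bool_lists_le: "card {xs :: bool list. length xs \<le> s} < 2 ^ Suc s"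
  and finite_bool_lists_le: "finite {xs :: bool list. length xs \<le> s}"
proof -
  have "(\<Sum>i\<le>s. 2 ^ i) < (2::nat) ^ Suc s"
    by (induction s) auto
  then show "card {xs :: bool list. length xs \<le> s} < 2 ^ Suc s"
    using card_lists_length_le[of "UNIV :: bool set" s] by (simp add: card_UNIV_bool)
  show "finite {xs :: bool list. length xs \<le> s}"
    using finite_lists_length_le[of "UNIV :: bool set" s] by simp
qed

text \<open>\<open>F\<close> factors through \<open>msg\<close>, so it takes no more values than
  there are bit strings of length at most \<open>s\<close>. Here \<open>msg\<close> will be the
  memory and \<open>F\<close> whatever is decoded from it.\<close>

lemma card_image_factor_le:
  assumes len: "\<And>x. x \<in> X \<Longrightarrow> length (msg x :: bool list) \<le> s"
    and dec: "\<And>x y. x \<in> X \<Longrightarrow> y \<in> X \<Longrightarrow> msg x = msg y \<Longrightarrow> F x = F y"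
  shows "card (F ` X) < 2 ^ Suc s"
proof -
  have sub: "msg ` X \<subseteq> {xs. length xs \<le> s}" using len by auto
  have fin: "finite (msg ` X)" using finite_subset[OF sub finite_bool_lists_le] .
  have "F ` X \<subseteq> (\<lambda>u. F (inv_into X msg u)) ` msg ` X"
  proof
    fix y assume "y \<in> F ` X"
    then obtain x where x: "x \<in> X" "y = F x" by auto
    have "F (inv_into X msg (msg x)) = F x"
      using x by (intro dec) (auto simp: inv_into_into f_inv_into_f)
    then show "y \<in> (\<lambda>u. F (inv_into X msg u)) ` msg ` X" using x by force
  qed
  then have "card (F ` X) \<le> card (msg ` X)"
    by (meson surj_card_le fin)
  also have "\<dots> \<le> card {xs :: bool list. length xs \<le> s}"
    by (rule card_mono[OF finite_bool_lists_le sub])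
  finally show ?thesis using card_bool_lists_le[of s] by simp
qed

text \<open>The memory at time \<open>T\<close> is all that the future inherits from the past: equal
  states, updated with the same coins and the same rows, stay equal.\<close>

lemma memory_at_cong:
  assumes "memory_at alg \<omega> r T = memory_at alg \<omega> r' T"
    and "\<And>k. T \<le> k \<Longrightarrow> r k = r' k" and "T \<le> t"
  shows "memory_at alg \<omega> r t = memory_at alg \<omega> r' t"
  using \<open>T \<le> t\<close> assms by (induction rule: dec_induct) auto

section \<open>A rate-distortion bound\<close>

lemma sum_power_card_Pow:
  assumes "finite U"
  shows "(\<Sum>x\<in>Pow U. z ^ card x) = (1 + z :: 'a :: comm_semiring_1) ^ card U"
  using prod_add[OF assms, of "\<lambda>_. z" "\<lambda>_. 1"] by (simp add: add.commute)

text \<open>Symmetric difference with \<open>g\<close> is an involution of \<open>Pow U\<close>,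
  which moves the centre of the Hamming ball to the empty set.\<close>

lemma sum_power_sym_diff_Pow:
  assumes "finite U" "g \<subseteq> U"
  shows "(\<Sum>x\<in>Pow U. z ^ card (sym_diff x g)) = (1 + z :: 'a :: comm_semiring_1) ^ card U"
proof -
  have "(\<Sum>x\<in>Pow U. z ^ card (sym_diff x g)) = (\<Sum>x\<in>Pow U. z ^ card x)"
    using assms(2)
    by (intro sum.reindex_bij_witness[of _ "\<lambda>x. sym_diff x g" "\<lambda>x. sym_diff x g"]) auto
  then show ?thesis using sum_power_card_Pow[OF assms(1)] by simp
qed

text \<open>
  A weak rate-distortion bound: the exponential moment of the Hamming error is at most
  \<open>2 ^ Suc s * (1 + 1/4) ^ N\<close>, whereas it is at least \<open>2 ^ N * (1/4) powr (N / 8)\<close>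
  by convexity.
\<close>

lemma lossy_compression_bound:
  fixes U :: "'a set"
  assumes U: "finite U" and F: "\<And>x. x \<in> Pow U \<Longrightarrow> F x \<subseteq> U"
    and card_F: "card (F ` Pow U) < 2 ^ Suc s"
    and err: "(\<Sum>x\<in>Pow U. real (card (sym_diff x (F x)))) \<le> 2 ^ card U * (real (card U) / 8)"
  shows "real (card U) / 4 \<le> real (Suc s)"
proof -
  define N where "N = card U"
  define e where "e x = card (sym_diff x (F x))" for x
  define l where "l = ln (4::real)"
  have l: "l > 0" by (simp add: l_def)
  have pw: "(1/4::real) ^ k = exp (- l * real k)" for k
  proof -
    have "exp (- l) = 1/4" by (simp add: l_def exp_minus)
    then show ?thesis by (simp only: exp_of_nat2_mult)
  qed
  have "(\<Sum>x\<in>Pow U. (1/4::real) ^ e x) \<le> (\<Sum>g\<in>F ` Pow U. \<Sum>x\<in>Pow U. (1/4) ^ card (sym_diff x g))"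
  proof -
    have "(\<Sum>x\<in>Pow U. (1/4::real) ^ e x) = (\<Sum>g\<in>F ` Pow U. \<Sum>x\<in>{x \<in> Pow U. F x = g}. (1/4) ^ e x)"
      using U by (intro sum.image_gen) auto
    also have "\<dots> = (\<Sum>g\<in>F ` Pow U. \<Sum>x\<in>{x \<in> Pow U. F x = g}. (1/4) ^ card (sym_diff x g))"
      by (intro sum.cong refl) (auto simp: e_def)
    \<comment> \<open>For each decoded value \<open>g\<close>, let \<open>x\<close> range over all
      of \<open>Pow U\<close> instead of the fibre of \<open>g\<close>; the inner sum then no longer
      depends on \<open>F\<close>.\<close>
    also have "\<dots> \<le> (\<Sum>g\<in>F ` Pow U. \<Sum>x\<in>Pow U. (1/4) ^ card (sym_diff x g))"
      using U by (intro sum_mono sum_mono2) auto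
    finally show ?thesis .
  qed
  also have "\<dots> = real (card (F ` Pow U)) * (5/4) ^ N"
  proof -
    have "(\<Sum>x\<in>Pow U. (1/4::real) ^ card (sym_diff x g)) = (5/4) ^ N" if "g \<in> F ` Pow U" for g
    proof -
      have "g \<subseteq> U" using that F by auto
      then show ?thesis using sum_power_sym_diff_Pow[OF U, of g "1/4::real"] by (simp add: N_def)
    qed
    then show ?thesis by simp
  qed
  also have "\<dots> \<le> 2 ^ Suc s * (5/4) ^ N"
    using card_F by (intro mult_right_mono) (simp_all add: nat_less_real_le flip: of_nat_less_iff)
  finally have upper: "(\<Sum>x\<in>Pow U. (1/4::real) ^ e x) \<le> 2 ^ Suc s * (5/4) ^ N" .

  define p where "p = real N / 8"
  \<comment> \<open>The convex function \<open>exp (- l * e)\<close> lies above its tangent at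
    \<open>p\<close>. Since the mean of \<open>e\<close> is at most \<open>p\<close> by
    \<open>err\<close>, the linear terms have a nonnegative sum.\<close>
  have tangent: "exp (- l * p) * (1 + l * (p - real (e x))) \<le> (1/4) ^ e x" for x
  proof -
    have "exp (- l * p) * (1 + l * (p - real (e x))) \<le> exp (- l * p) * exp (l * (p - real (e x)))"
      by (intro mult_left_mono exp_ge_add_one_self) auto
    also have "\<dots> = (1/4) ^ e x"
      by (simp add: pw algebra_simps flip: exp_add)
    finally show ?thesis .
  qed
  have "2 ^ N * exp (- l * p) \<le> exp (- l * p) * (2 ^ N + l * (2 ^ N * p - (\<Sum>x\<in>Pow U. real (e x))))"
    using err l by (simp add: p_def e_def N_def)
  also have "\<dots> = (\<Sum>x\<in>Pow U. exp (- l * p) * (1 + l * (p - real (e x))))"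
    using U by (simp add: sum.distrib sum_subtractf card_Pow N_def
        flip: sum_distrib_left)
  also have "\<dots> \<le> (\<Sum>x\<in>Pow U. (1/4) ^ e x)"
    by (intro sum_mono tangent)
  finally have main: "2 ^ N * exp (- l * p) \<le> 2 ^ Suc s * (5/4) ^ N"
    using upper by linarith
  have two: "(2::real) ^ k = 2 powr real k" for k by (simp add: powr_realpow)
  have l2: "l = 2 * ln 2" using ln_realpow[of 2 2] by (simp add: l_def)
  have exp_eq: "exp (- l * p) = 2 powr (- (real N / 4))"
    by (simp add: powr_def l2 p_def)
  \<comment> \<open>With \<open>5/4 \<le> sqrt 2\<close> all factors become powers of 2, and
    comparing exponents gives \<open>N - N/4 \<le> Suc s + N/2\<close>.\<close>
  have "(5/4::real) ^ N \<le> (2 powr (1/2)) ^ N"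
  proof (rule power_mono)
    have "5/4 \<le> sqrt 2" by (rule real_le_rsqrt) (simp add: power2_eq_square)
    then show "5/4 \<le> (2::real) powr (1/2)" by (simp only: powr_half_sqrt)
  qed simp
  also have "\<dots> = 2 powr (real N / 2)"
    by (simp add: powr_powr flip: powr_realpow)
  finally have "2 powr real (Suc s) * (5/4) ^ N \<le> 2 powr real (Suc s) * 2 powr (real N / 2)"
    by (intro mult_left_mono) simp_all
  then have "2 powr real N * 2 powr (- (real N / 4)) \<le> 2 powr real (Suc s) * 2 powr (real N / 2)"
    using main unfolding exp_eq two by linarith
  then have "2 powr (real N + - (real N / 4)) \<le> 2 powr (real (Suc s) + real N / 2)"
    by (simp only: powr_add)
  then have "real N + - (real N / 4) \<le> real (Suc s) + real N / 2"
    by (rule powr_le_cancel_iff[THEN iffD1, rotated]) simp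
  then show ?thesis unfolding N_def by linarith
qed

section \<open>Gram matrix and Frobenius norm of a window\<close>

text \<open>Reindexing by arrival time \<open>k\<close> instead of by position in the window makes
  it easy to drop zero rows and to split the sums into blocks later.\<close>

lemma
  assumes r: "r \<in> row_streams n E" and t: "W \<le> t"
  shows dim_row_window_matrix: "dim_row (window_matrix n W r t) = W"
    and dim_col_window_matrix: "dim_col (window_matrix n W r t) = n"
    and gram_window_matrix: "\<And>q j. q < n \<Longrightarrow> j < n \<Longrightarrow>
      (transpose_mat (window_matrix n W r t) * window_matrix n W r t) $$ (q, j) =
        (\<Sum>k\<in>{t - W..<t}. r k $ q * r k $ j)"
    and frobenius_window_matrix: "(frobenius_norm (window_matrix n W r t))\<^sup>2 =
        (\<Sum>k\<in>{t - W..<t}. \<Sum>j<n. (r k $ j)\<^sup>2)"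
proof -
  show dr: "dim_row (window_matrix n W r t) = W" and dc: "dim_col (window_matrix n W r t) = n"
    using t by (auto simp: window_matrix_def)
  have entry: "window_matrix n W r t $$ (l, j) = r (t - W + l) $ j" if "l < W" "j < n" for l j
    using that t by (simp add: window_matrix_def mat_of_rows_index)
  have shift: "(\<Sum>l<W. f (t - W + l)) = (\<Sum>k\<in>{t - W..<t}. f k)" for f :: "nat \<Rightarrow> real"
    using t sum.shift_bounds_nat_ivl[of f 0 "t - W" W] by (simp add: add.commute atLeast0LessThan)
  show "(transpose_mat (window_matrix n W r t) * window_matrix n W r t) $$ (q, j) =
        (\<Sum>k\<in>{t - W..<t}. r k $ q * r k $ j)" if "q < n" "j < n" for q j
  proof -
    have "(transpose_mat (window_matrix n W r t) * window_matrix n W r t) $$ (q, j) =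
        (\<Sum>l<W. window_matrix n W r t $$ (l, q) * window_matrix n W r t $$ (l, j))"
      using that by (simp add: dr dc scalar_prod_def atLeast0LessThan)
    also have "\<dots> = (\<Sum>l<W. r (t - W + l) $ q * r (t - W + l) $ j)"
      using that by (intro sum.cong refl) (simp add: entry)
    finally have "(transpose_mat (window_matrix n W r t) * window_matrix n W r t) $$ (q, j) =
        (\<Sum>l<W. r (t - W + l) $ q * r (t - W + l) $ j)" .
    then show ?thesis using shift by simp
  qed
  have "(frobenius_norm (window_matrix n W r t))\<^sup>2 = (\<Sum>l<W. \<Sum>j<n. (r (t - W + l) $ j)\<^sup>2)"
  proof -
    have "(frobenius_norm (window_matrix n W r t))\<^sup>2 = (\<Sum>l<W. \<Sum>j<n. (window_matrix n W r t $$ (l, j))\<^sup>2)"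
      unfolding frobenius_norm_def by (simp add: dr dc sum_nonneg)
    also have "\<dots> = (\<Sum>l<W. \<Sum>j<n. (r (t - W + l) $ j)\<^sup>2)"
      by (intro sum.cong refl) (simp add: entry)
    finally show ?thesis .
  qed
  then show "(frobenius_norm (window_matrix n W r t))\<^sup>2 = (\<Sum>k\<in>{t - W..<t}. \<Sum>j<n. (r k $ j)\<^sup>2)"
    using shift[of "\<lambda>k. \<Sum>j<n. (r k $ j)\<^sup>2"] by simp
qed

text \<open>Any set of entries of the error matrix carries at most its whole squared Frobenius norm.
  This is what limits the number of badly approximated entries.\<close>

lemma covariance_approx_entries:
  assumes ap: "covariance_approx \<epsilon> A B" and S: "S \<subseteq> {..<dim_col A} \<times> {..<dim_col A}"
  shows "(\<Sum>p\<in>S. ((transpose_mat A * A) $$ p - (transpose_mat B * B) $$ p)\<^sup>2)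
    \<le> (\<epsilon> * (frobenius_norm A)\<^sup>2)\<^sup>2"
proof -
  let ?n = "dim_col A" and ?D = "transpose_mat A * A - transpose_mat B * B"
  have dim: "dim_col B = ?n" and le: "frobenius_norm ?D \<le> \<epsilon> * (frobenius_norm A)\<^sup>2"
    using ap by (auto simp: covariance_approx_def)
  have "(\<Sum>p\<in>S. ((transpose_mat A * A) $$ p - (transpose_mat B * B) $$ p)\<^sup>2)
    = (\<Sum>p\<in>S. (?D $$ p)\<^sup>2)"
    using S dim by (intro sum.cong refl) auto
  also have "\<dots> \<le> (\<Sum>p\<in>{..<?n} \<times> {..<?n}. (?D $$ p)\<^sup>2)"
    using S by (intro sum_mono2) auto
  also have "\<dots> = (\<Sum>i<?n. \<Sum>j<?n. (?D $$ (i, j))\<^sup>2)"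
    by (simp add: sum.cartesian_product)
  also have "\<dots> = (frobenius_norm ?D)\<^sup>2"
    using dim by (simp add: frobenius_norm_def sum_nonneg)
  also have "\<dots> \<le> (\<epsilon> * (frobenius_norm A)\<^sup>2)\<^sup>2"
    using le by (intro power_mono) (auto simp: frobenius_norm_def sum_nonneg)
  finally show ?thesis .
qed

section \<open>Unrestricted real entries\<close>

text \<open>Stream \<open>i\<close> has the single nonzero entry \<open>2 ^ i\<close>, so the corner
  of its Gram matrix is \<open>4 ^ i\<close>. A relative error of 1/4 leaves these values in
  disjoint intervals, so successful streams need distinct memories.\<close>

lemma no_bounded_space_real_entries:
  assumes n: "1 \<le> n" and W: "1 \<le> W" and \<epsilon>: "\<epsilon> \<le> 1 / 4"
    and alg: "sliding_window_covariance n W UNIV \<epsilon> (8 / 9) alg"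
    and space: "uses_space n UNIV alg s"
  shows False
proof -
  define r :: "nat \<Rightarrow> nat \<Rightarrow> real vec" where
    "r i k = vec n (\<lambda>j. if k = 0 \<and> j = 0 then 2 ^ i else 0)" for i k
  have rs: "r i \<in> row_streams n UNIV" for i by (simp add: r_def row_streams_def)
  let ?P = "\<lambda>i \<omega>. covariance_approx \<epsilon> (window_matrix n W (r i) W) (output_at alg \<omega> (r i) W)"
  \<comment> \<open>Twice the bound \<open>2 ^ Suc s\<close> on the number of memories, so 8/9 of
    the streams are still too many.\<close>
  define M :: nat where "M = 2 ^ (s + 2)"
  have "\<exists>\<omega>. 8 / 9 * real (card {..<M}) \<le> real (card {i \<in> {..<M}. ?P i \<omega>})"
    using alg rs by (intro exists_coins_many_events) (auto simp: sliding_window_covariance_def)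
  then obtain \<omega> where \<omega>: "8 / 9 * real M \<le> real (card {i \<in> {..<M}. ?P i \<omega>})" by auto
  define G where "G i = (let B = output_at alg \<omega> (r i) W in (transpose_mat B * B) $$ (0, 0))" for i
  have gram: "\<bar>4 ^ i - G i\<bar> \<le> 4 ^ i / 4" if "?P i \<omega>" for i
  proof -
    let ?A = "window_matrix n W (r i) W"
    have first: "{0..<W} = insert 0 {1..<W}" "{..<n} = insert 0 {1..<n}" using W n by auto
    have *: "(transpose_mat ?A * ?A) $$ (0, 0) = 4 ^ i"
      using gram_window_matrix[OF rs order_refl, of 0 0 W] n
      by (simp add: r_def first if_distrib power_mult_distrib[symmetric] cong: if_cong)
    have **: "(frobenius_norm ?A)\<^sup>2 = 4 ^ i"
      using frobenius_window_matrix[OF rs order_refl, of W i] n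
      by (simp add: r_def first power2_eq_square power_mult_distrib[symmetric])
    have "(4 ^ i - G i)\<^sup>2 \<le> (\<epsilon> * 4 ^ i)\<^sup>2"
      using covariance_approx_entries[OF that, of "{(0, 0)}"] n
      by (simp add: * ** G_def Let_def dim_col_window_matrix[OF rs order_refl])
    \<comment> \<open>The sign comes from success itself: this product bounds a Frobenius
      norm.\<close>
    moreover have "0 \<le> \<epsilon> * 4 ^ i"
    proof -
      have "0 \<le> frobenius_norm (transpose_mat ?A * ?A - transpose_mat (output_at alg \<omega> (r i) W) * output_at alg \<omega> (r i) W)"
        by (simp add: frobenius_norm_def sum_nonneg)
      then show ?thesis using that by (simp add: covariance_approx_def ** )
    qed
    ultimately have "\<bar>4 ^ i - G i\<bar> \<le> \<epsilon> * 4 ^ i"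
      by (metis abs_of_nonneg real_sqrt_abs real_sqrt_le_iff)
    also have "\<dots> \<le> 4 ^ i / 4" using mult_right_mono[OF \<epsilon>, of "4 ^ i"] by simp
    finally show ?thesis .
  qed
  have inj: "inj_on G {i \<in> {..<M}. ?P i \<omega>}"
  proof -
    have "G i < G j" if "?P i \<omega>" "?P j \<omega>" "i < j" for i j
    proof -
      have "(4::real) ^ Suc i \<le> 4 ^ j" using that by (intro power_increasing) auto
      moreover have "(4::real) ^ i > 0" by simp
      ultimately show ?thesis using gram[OF that(1)] gram[OF that(2)] unfolding power_Suc by linarith
    qed
    then show ?thesis by (auto simp: inj_on_def) (metis less_irrefl linorder_neqE_nat)
  qed
  have "card (G ` {i \<in> {..<M}. ?P i \<omega>}) < 2 ^ Suc s"
  proof (rule card_image_factor_le)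
    show "length (memory_at alg \<omega> (r i) W) \<le> s" for i
      using space rs by (auto simp: uses_space_def)
    show "G i = G j" if "memory_at alg \<omega> (r i) W = memory_at alg \<omega> (r j) W" for i j
      using that by (simp add: G_def output_at_def)
  qed
  then have "card {i \<in> {..<M}. ?P i \<omega>} < 2 ^ Suc s"
    by (simp only: card_image[OF inj])
  then have "real (card {i \<in> {..<M}. ?P i \<omega>}) < real (2 ^ Suc s)"
    by (simp only: of_nat_less_iff)
  with \<omega> have "8 / 9 * real M < 2 ^ Suc s" by simp
  moreover have "real M = 2 * 2 ^ Suc s" by (simp add: M_def)
  moreover have "(2::real) ^ Suc s > 0" by simp
  ultimately show False by argo
qed

section \<open>Hard streams and their windows\<close>

lemma sum_blocks:
  fixes f :: "nat \<Rightarrow> 'a :: comm_monoid_add"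
  assumes "i \<le> m"
  shows "(\<Sum>k\<in>{i * d..<m * d}. f k) = (\<Sum>b\<in>{i..<m}. \<Sum>q<d. f (b * d + q))"
  using assms
proof (induction m rule: dec_induct)
  case (step m)
  have "(\<Sum>k\<in>{i * d..<Suc m * d}. f k) = (\<Sum>k\<in>{i * d..<m * d}. f k) + (\<Sum>k\<in>{m * d..<Suc m * d}. f k)"
    using step.hyps by (intro sum.atLeastLessThan_concat[symmetric]) auto
  also have "(\<Sum>k\<in>{m * d..<Suc m * d}. f k) = (\<Sum>q<d. f (m * d + q))"
    using sum.shift_bounds_nat_ivl[of f 0 "m * d" d] by (simp add: add.commute atLeast0LessThan)
  finally show ?case using step by simp
qed simp

text \<open>\<open>md_le\<close> lets all blocks fit into one window, and \<open>d_le\<close> leaves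
  at least half of the columns for bits. With \<open>h\<close> of order \<open>sqrt n\<close>, the
  marker of a row weighs about as much as its bits can. The largest entry is
  \<open>2 ^ (m - 1) * h\<close>.\<close>

locale hard_streams =
  fixes n m d h W :: nat and \<epsilon> :: real and E :: "real set"
  assumes d_pos: "0 < d" and d_le: "2 * d \<le> n"
    and h_lower: "n \<le> h\<^sup>2" and h_upper: "h\<^sup>2 \<le> 4 * n"
    and md_le: "m * d \<le> W"
    and \<epsilon>_pos: "0 < \<epsilon>" and \<epsilon>_d: "192\<^sup>2 * \<epsilon>\<^sup>2 * real d \<le> 1"
    and entries: "{real_of_int z | z. \<bar>z\<bar> \<le> 2 ^ (m - 1) * int h} \<subseteq> E"
begin

text \<open>A message is a subset \<open>x\<close> of these positions: \<open>(k, j)\<close> stands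
  for the bit in column \<open>j\<close> of the row arriving at time \<open>k\<close>.\<close>

definition bits :: "(nat \<times> nat) set" where
  "bits = {..<m * d} \<times> {d..<n}"

text \<open>
  Row \<open>q\<close> of block \<open>b\<close> is \<open>2 ^ (m - 1 - b)\<close> times \<open>(h e\<^sub>q, y)\<close>, where \<open>e\<^sub>q\<close> is a unit
  vector of length \<open>d\<close> and \<open>y\<close> is the 0-1 vector of the bits stored in that row.
\<close>

definition row :: "(nat \<times> nat) set \<Rightarrow> nat \<Rightarrow> real vec" where
  "row x k = vec n (\<lambda>j. if k < m * d
     then 2 ^ (m - 1 - k div d) *
       (if j < d then (if j = k mod d then real h else 0) else of_bool ((k, j) \<in> x))
     else 0)"

lemma h_pos: "0 < h"
  using h_lower d_pos d_le by (cases h) auto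

lemma finite_bits: "finite bits"
  by (simp add: bits_def)

lemma card_bits: "card bits = m * d * (n - d)"
  by (simp add: bits_def)

lemma row_in_row_streams: "row x \<in> row_streams n E"
proof -
  have scaled: "2 ^ (m - 1 - b) * real a \<in> E" if "a \<le> h" for a b
  proof -
    have "(2::int) ^ (m - 1 - b) * int a \<le> 2 ^ (m - 1) * int h"
      using that by (intro mult_mono power_increasing) auto
    then have "real_of_int (2 ^ (m - 1 - b) * int a) \<in> {real_of_int z | z. \<bar>z\<bar> \<le> 2 ^ (m - 1) * int h}"
      by (intro CollectI exI[of _ "2 ^ (m - 1 - b) * int a"]) (simp add: abs_mult)
    then show ?thesis using entries by auto
  qed
  have "row x k $ j \<in> E" if "j < n" for k j
    using that scaled[of 0 "k div d"] scaled[of 1 "k div d"] scaled[of h "k div d"] h_pos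
    by (auto simp: row_def)
  then show ?thesis
    by (auto simp: row_streams_def vec_set_def) (auto simp: row_def)
qed

text \<open>At time \<open>W + i * d\<close> the blocks before \<open>i\<close> have expired, and
  the rows from time \<open>m * d\<close> on are zero. The index set \<open>J\<close> allows both a
  single Gram entry (\<open>J = {()}\<close>) and the Frobenius norm
  (\<open>J = {..<n}\<close>).\<close>

lemma sum_over_window:
  fixes a c :: "'j \<Rightarrow> nat"
  assumes "i < m" and "a ` J \<subseteq> {..<n}"
  shows "(\<Sum>k\<in>{i * d..<W + i * d}. \<Sum>j\<in>J. row x k $ a j * row x k $ c j) =
    (\<Sum>b\<in>{i..<m}. \<Sum>q<d. \<Sum>j\<in>J. row x (b * d + q) $ a j * row x (b * d + q) $ c j)"
proof -
  let ?f = "\<lambda>k. \<Sum>j\<in>J. row x k $ a j * row x k $ c j"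
  have "(\<Sum>k\<in>{i * d..<W + i * d}. ?f k) = (\<Sum>k\<in>{i * d..<m * d}. ?f k)"
    using md_le assms(2)
    by (intro sum.mono_neutral_right) (auto simp: row_def image_subset_iff intro!: sum.neutral)
  also have "\<dots> = (\<Sum>b\<in>{i..<m}. \<Sum>q<d. ?f (b * d + q))"
    using assms(1) by (intro sum_blocks) simp
  finally show ?thesis .
qed

lemma row_block_nth:
  assumes "b < m" "q < d" "j < n"
  shows "row x (b * d + q) $ j = 2 ^ (m - 1 - b) *
    (if j < d then (if j = q then real h else 0) else of_bool ((b * d + q, j) \<in> x))"
proof -
  have "b * d + q < Suc b * d" using assms by simp
  also have "\<dots> \<le> m * d" using assms by (intro mult_le_mono1) simp
  finally show ?thesis using assms by (simp add: row_def)
qed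

text \<open>Squared scales drop by a factor 4 per block, so the blocks after \<open>i\<close>
  together weigh less than a third of block \<open>i\<close>.\<close>

lemma geometric_tail: "i \<le> m \<Longrightarrow> 3 * (\<Sum>b\<in>{i..<m}. 4 ^ (m - 1 - b)) = 4 ^ (m - i) - (1::real)"
proof (induction rule: inc_induct)
  case (step i)
  define k where "k = m - 1 - i"
  have k: "m - i = Suc k" "m - Suc i = k" using step.hyps by (auto simp: k_def)
  have "(\<Sum>b\<in>{i..<m}. 4 ^ (m - 1 - b)) = 4 ^ k + (\<Sum>b\<in>{Suc i..<m}. 4 ^ (m - 1 - b) :: real)"
    using sum.atLeast_Suc_lessThan[OF step.hyps(2)] by (simp add: k_def)
  then show ?case using step.IH unfolding k by simp
qed simp

definition window :: "(nat \<times> nat) set \<Rightarrow> nat \<Rightarrow> real mat" where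
  "window x i = window_matrix n W (row x) (W + i * d)"

lemma four_power: "2 ^ k * (2 ^ k * c) = 4 ^ k * (c :: real)"
  by (simp add: power_mult_distrib[symmetric] mult.assoc[symmetric])

text \<open>Column \<open>q < d\<close> is nonzero only in the \<open>q\<close>-th row of each
  block, so the marker singles out one bit per block.\<close>

lemma gram_window:
  assumes "i < m" "q < d" "j \<in> {d..<n}"
  shows "(transpose_mat (window x i) * window x i) $$ (q, j) =
    (\<Sum>b\<in>{i..<m}. 4 ^ (m - 1 - b) * real h * of_bool ((b * d + q, j) \<in> x))"
proof -
  have qj: "q < n" "j < n" "\<not> j < d" using assms d_le by auto
  have "(transpose_mat (window x i) * window x i) $$ (q, j) =
    (\<Sum>k\<in>{i * d..<W + i * d}. \<Sum>_\<in>{()}. row x k $ q * row x k $ j)"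
    using gram_window_matrix[OF row_in_row_streams, of W "W + i * d" q j] qj
    by (simp add: window_def)
  also have "\<dots> = (\<Sum>b\<in>{i..<m}. \<Sum>p<d. row x (b * d + p) $ q * row x (b * d + p) $ j)"
    using qj by (subst sum_over_window[OF assms(1)]) auto
  also have "\<dots> = (\<Sum>b\<in>{i..<m}. \<Sum>p<d. if p = q then 4 ^ (m - 1 - b) * real h * of_bool ((b * d + q, j) \<in> x) else 0)"
    using assms qj
    by (intro sum.cong refl) (auto simp: row_block_nth four_power mult_ac)
  finally show ?thesis using assms by simp
qed

lemma gram_window_bit:
  fixes x
  assumes "i < m" "q < d" "j \<in> {d..<n}"
  defines "G \<equiv> (transpose_mat (window x i) * window x i) $$ (q, j)"
  shows "(i * d + q, j) \<in> x \<Longrightarrow> real h * 4 ^ (m - 1 - i) \<le> G"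
    and "(i * d + q, j) \<notin> x \<Longrightarrow> G \<le> real h * 4 ^ (m - 1 - i) / 3"
proof -
  define R where "R = (\<Sum>b\<in>{Suc i..<m}. 4 ^ (m - 1 - b) * real h * of_bool ((b * d + q, j) \<in> x))"
  have G: "G = 4 ^ (m - 1 - i) * real h * of_bool ((i * d + q, j) \<in> x) + R"
    unfolding G_def R_def gram_window[OF assms(1-3)] by (rule sum.atLeast_Suc_lessThan[OF assms(1)])
  have "0 \<le> R" by (auto simp: R_def intro!: sum_nonneg)
  then show "real h * 4 ^ (m - 1 - i) \<le> G" if "(i * d + q, j) \<in> x"
    using that G by (simp add: mult.commute)
  have "R \<le> (\<Sum>b\<in>{Suc i..<m}. 4 ^ (m - 1 - b) * real h)"
    unfolding R_def by (intro sum_mono) auto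
  also have "\<dots> = real h * (\<Sum>b\<in>{Suc i..<m}. 4 ^ (m - 1 - b))"
    by (simp add: sum_distrib_left mult.commute)
  also have "\<dots> \<le> real h * (4 ^ (m - 1 - i) / 3)"
    using geometric_tail[of "Suc i"] assms(1) by (intro mult_left_mono) auto
  finally show "G \<le> real h * 4 ^ (m - 1 - i) / 3" if "(i * d + q, j) \<notin> x"
    using that G by simp
qed

text \<open>Up to its squared scale, a row has squared norm at most
  \<open>h\<^sup>2 + n \<le> 2 * h\<^sup>2\<close>; the geometric sum over the blocks contributes
  the factor 4/3.\<close>

lemma frobenius_window:
  assumes "i < m"
  shows "(frobenius_norm (window x i))\<^sup>2 \<le> 8 / 3 * 4 ^ (m - 1 - i) * real d * (real h)\<^sup>2"
proof -
  have row_le: "(\<Sum>j<n. row x (b * d + q) $ j * row x (b * d + q) $ j) \<le> 4 ^ (m - 1 - b) * (2 * (real h)\<^sup>2)"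
    if "b < m" "q < d" for b q
  proof -
    have "(\<Sum>j<n. row x (b * d + q) $ j * row x (b * d + q) $ j) \<le>
      (\<Sum>j<n. 4 ^ (m - 1 - b) * ((if j = q then (real h)\<^sup>2 else 0) + 1))"
    proof (intro sum_mono)
      fix j assume "j \<in> {..<n}"
      then have "row x (b * d + q) $ j * row x (b * d + q) $ j = 4 ^ (m - 1 - b) *
        (if j < d then (if j = q then real h else 0) else of_bool ((b * d + q, j) \<in> x))\<^sup>2"
        using that by (simp add: row_block_nth four_power power2_eq_square mult_ac)
      also have "\<dots> \<le> 4 ^ (m - 1 - b) * ((if j = q then (real h)\<^sup>2 else 0) + 1)"
        by (intro mult_left_mono) auto
      finally show "row x (b * d + q) $ j * row x (b * d + q) $ j \<le> \<dots>" .
    qed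
    also have "\<dots> = 4 ^ (m - 1 - b) * ((real h)\<^sup>2 + real n)"
      using that d_le by (simp add: sum.distrib flip: sum_distrib_left)
    also have "\<dots> \<le> 4 ^ (m - 1 - b) * (2 * (real h)\<^sup>2)"
      using h_lower by (intro mult_left_mono) (simp_all flip: of_nat_power)
    finally show ?thesis .
  qed
  have "(frobenius_norm (window x i))\<^sup>2 =
    (\<Sum>k\<in>{i * d..<W + i * d}. \<Sum>j<n. row x k $ j * row x k $ j)"
    using frobenius_window_matrix[OF row_in_row_streams, of W "W + i * d"]
    by (simp add: window_def power2_eq_square)
  also have "\<dots> = (\<Sum>b\<in>{i..<m}. \<Sum>q<d. \<Sum>j<n. row x (b * d + q) $ j * row x (b * d + q) $ j)"
    by (rule sum_over_window[OF assms]) auto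
  also have "\<dots> \<le> (\<Sum>b\<in>{i..<m}. \<Sum>q<d. 4 ^ (m - 1 - b) * (2 * (real h)\<^sup>2))"
    by (intro sum_mono row_le) auto
  also have "\<dots> = real d * (2 * (real h)\<^sup>2) * (\<Sum>b\<in>{i..<m}. 4 ^ (m - 1 - b))"
    by (simp add: sum_distrib_left mult_ac)
  also have "\<dots> \<le> real d * (2 * (real h)\<^sup>2) * (4 / 3 * 4 ^ (m - 1 - i))"
  proof (intro mult_left_mono)
    have "m - i = Suc (m - 1 - i)" using assms by simp
    then show "(\<Sum>b\<in>{i..<m}. 4 ^ (m - 1 - b)) \<le> 4 / 3 * (4::real) ^ (m - 1 - i)"
      using geometric_tail[of i] assms by simp
  qed simp
  finally show ?thesis by (simp add: mult_ac)
qed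

section \<open>Decoding the stored bits\<close>

text \<open>The threshold 2/3 is the midpoint between the bounds 1/3 and 1 of
  \<open>gram_window_bit\<close>. Each block is read when it is the oldest one in the window. The
  message \<open>x\<close> enters only through the outputs.\<close>

definition decoded :: "streaming_algorithm \<Rightarrow> (nat \<Rightarrow> bool) \<Rightarrow> (nat \<times> nat) set \<Rightarrow> (nat \<times> nat) set" where
  "decoded alg \<omega> x = {(k, j) \<in> bits.
     let B = output_at alg \<omega> (row x) (W + k div d * d)
     in 2 / 3 * (real h * 4 ^ (m - 1 - k div d)) \<le> (transpose_mat B * B) $$ (k mod d, j)}"

definition errors :: "streaming_algorithm \<Rightarrow> (nat \<Rightarrow> bool) \<Rightarrow> (nat \<times> nat) set \<Rightarrow> nat \<Rightarrow> (nat \<times> nat) set" where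
  "errors alg \<omega> x i = {p \<in> sym_diff x (decoded alg \<omega> x). fst p div d = i}"

lemma errors_subset: "x \<subseteq> bits \<Longrightarrow> errors alg \<omega> x i \<subseteq> {i * d..<i * d + d} \<times> {d..<n}"
proof -
  have "k \<in> {k div d * d..<k div d * d + d}" for k
    using div_mult_mod_eq[of k d] mod_less_divisor[OF d_pos, of k]
    unfolding atLeastLessThan_iff by (intro conjI; linarith)
  then show "x \<subseteq> bits \<Longrightarrow> ?thesis"
    by (auto simp: errors_def decoded_def bits_def split: prod.splits)
qed

lemma card_errors_le: "x \<subseteq> bits \<Longrightarrow> card (errors alg \<omega> x i) \<le> d * (n - d)"
  using card_mono[OF _ errors_subset[of x alg \<omega> i]] by simp

text \<open>A wrong bit costs an error of at least \<open>h * S / 3\<close> in its Gram entry, while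
  the squares of all errors sum to at most
  \<open>(\<epsilon> * (8 / 3 * S * d * h\<^sup>2))\<^sup>2\<close>. The scale \<open>S\<close>
  cancels in the quotient.\<close>

lemma card_errors_success:
  assumes x: "x \<subseteq> bits" and i: "i < m"
    and ap: "covariance_approx \<epsilon> (window x i) (output_at alg \<omega> (row x) (W + i * d))"
  shows "real (card (errors alg \<omega> x i)) \<le> real (d * (n - d)) / 72"
proof -
  define B where "B = output_at alg \<omega> (row x) (W + i * d)"
  define S :: real where "S = 4 ^ (m - 1 - i)"
  define g where "g p = ((transpose_mat (window x i) * window x i) $$ p - (transpose_mat B * B) $$ p)\<^sup>2" for p
  define \<phi> where "\<phi> p = (fst p mod d, snd p)" for p :: "nat \<times> nat"
  let ?Er = "errors alg \<omega> x i"
  have S: "S > 0" by (simp add: S_def)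
  have sub: "?Er \<subseteq> {i * d..<i * d + d} \<times> {d..<n}" by (rule errors_subset[OF x])
  \<comment> \<open>Within one block the quotient by \<open>d\<close> is fixed, so distinct bits are
    charged to distinct Gram entries.\<close>
  have inj: "inj_on \<phi> ?Er"
  proof (rule inj_onI)
    fix p p' assume "p \<in> ?Er" "p' \<in> ?Er" "\<phi> p = \<phi> p'"
    then have "fst p div d = fst p' div d" "fst p mod d = fst p' mod d" "snd p = snd p'"
      by (auto simp: errors_def \<phi>_def)
    then show "p = p'" by (metis div_mult_mod_eq prod_eqI)
  qed
  have far: "(real h * S / 3)\<^sup>2 \<le> g (\<phi> p)" if "p \<in> ?Er" for p
  proof -
    obtain k j where p: "p = (k, j)" by (cases p)
    define q where "q = k mod d"
    have k: "k div d = i" and xd: "((k, j) \<in> x) \<noteq> ((k, j) \<in> decoded alg \<omega> x)"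
      using that by (auto simp: errors_def p)
    have bits: "(k, j) \<in> bits" using that x by (auto simp: errors_def p decoded_def)
    have q: "q < d" "k = i * d + q" using d_pos k by (auto simp: q_def)
    have j: "j \<in> {d..<n}" using bits by (simp add: bits_def)
    have dec: "(k, j) \<in> decoded alg \<omega> x \<longleftrightarrow> 2 / 3 * (real h * S) \<le> (transpose_mat B * B) $$ (q, j)"
      using bits by (simp add: decoded_def Let_def k q_def B_def S_def)
    have "real h * S / 3 \<le> \<bar>(transpose_mat (window x i) * window x i) $$ (q, j) - (transpose_mat B * B) $$ (q, j)\<bar>"
    proof (cases "(k, j) \<in> x")
      case True
      then have "real h * S \<le> (transpose_mat (window x i) * window x i) $$ (q, j)"
        using gram_window_bit(1)[OF i q(1) j, of x] q(2) by (simp add: S_def)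
      moreover have "\<not> 2 / 3 * (real h * S) \<le> (transpose_mat B * B) $$ (q, j)"
        using xd dec True by blast
      ultimately show ?thesis by linarith
    next
      case False
      then have "(transpose_mat (window x i) * window x i) $$ (q, j) \<le> real h * S / 3"
        using gram_window_bit(2)[OF i q(1) j, of x] q(2) by (simp add: S_def)
      moreover have "2 / 3 * (real h * S) \<le> (transpose_mat B * B) $$ (q, j)"
        using xd dec False by blast
      ultimately show ?thesis by linarith
    qed
    then have "(real h * S / 3)\<^sup>2 \<le> \<bar>(transpose_mat (window x i) * window x i) $$ (q, j) - (transpose_mat B * B) $$ (q, j)\<bar>\<^sup>2"
      using S by (intro power_mono) auto
    then show ?thesis by (simp add: g_def \<phi>_def p q_def)
  qed
  have "real (card ?Er) * (real h * S / 3)\<^sup>2 \<le> (\<Sum>p\<in>?Er. g (\<phi> p))"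
    using sum_mono[of ?Er "\<lambda>_. (real h * S / 3)\<^sup>2", OF far] by simp
  also have "\<dots> = (\<Sum>p\<in>\<phi> ` ?Er. g p)" by (simp add: sum.reindex[OF inj])
  also have "\<dots> \<le> (\<epsilon> * (frobenius_norm (window x i))\<^sup>2)\<^sup>2"
    unfolding g_def
  proof (rule covariance_approx_entries)
    show "covariance_approx \<epsilon> (window x i) B" using ap by (simp add: B_def)
    have "dim_col (window x i) = n"
      unfolding window_def by (rule dim_col_window_matrix[OF row_in_row_streams]) simp
    then show "\<phi> ` ?Er \<subseteq> {..<dim_col (window x i)} \<times> {..<dim_col (window x i)}"
      using sub d_pos d_le by (auto simp: \<phi>_def intro: less_le_trans[OF mod_less_divisor])
  qed
  also have "\<dots> \<le> (\<epsilon> * (8 / 3 * S * real d * (real h)\<^sup>2))\<^sup>2"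
    using frobenius_window[OF i, of x] \<epsilon>_pos
    by (intro power_mono mult_left_mono) (auto simp: S_def)
  also have "\<dots> = (64 * \<epsilon>\<^sup>2 * (real d)\<^sup>2 * (real h)\<^sup>2) * (real h * S / 3)\<^sup>2"
    by (simp add: power2_eq_square field_simps)
  finally have "real (card ?Er) \<le> 64 * \<epsilon>\<^sup>2 * (real d)\<^sup>2 * (real h)\<^sup>2"
    using S h_pos by (simp add: mult_le_cancel_right_pos)
  also have "\<dots> \<le> 64 * \<epsilon>\<^sup>2 * (real d)\<^sup>2 * (8 * real (n - d))"
  proof (intro mult_left_mono)
    have "(real h)\<^sup>2 \<le> real (4 * n)" using h_upper by (simp flip: of_nat_power)
    also have "\<dots> \<le> real (8 * (n - d))" using d_le by (intro of_nat_mono) simp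
    finally show "(real h)\<^sup>2 \<le> 8 * real (n - d)" by simp
  qed simp
  \<comment> \<open>The origin of 192: \<open>64 * 8 * 72 = 192\<^sup>2\<close>.\<close>
  also have "\<dots> = (192\<^sup>2 * \<epsilon>\<^sup>2 * real d) * (real (d * (n - d)) / 72)"
    by (simp add: power2_eq_square)
  also have "\<dots> \<le> 1 * (real (d * (n - d)) / 72)"
    using \<epsilon>_d by (intro mult_right_mono) auto
  finally show ?thesis by simp
qed

lemma space_lower_bound:
  assumes alg: "sliding_window_covariance n W E \<epsilon> (8 / 9) alg" and space: "uses_space n E alg s"
  shows "real (m * d * (n - d)) / 4 \<le> real (Suc s)"
proof -
  define N where "N = card bits"
  define D where "D = real (d * (n - d))"
  define P where "P xi \<omega> \<longleftrightarrow> covariance_approx \<epsilon> (window (fst xi) (snd xi))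
    (output_at alg \<omega> (row (fst xi)) (W + snd xi * d))" for xi \<omega>
  \<comment> \<open>The tests are pairs of a message and a block to query, so one tape is good on
    average for all queries of all messages.\<close>
  define I where "I = Pow bits \<times> {..<m}"
  have finI: "finite I" by (simp add: I_def finite_bits)
  have cardI: "real (card I) = 2 ^ N * real m"
    by (simp add: I_def card_cartesian_product card_Pow finite_bits N_def)
  have N: "real N = real m * D" by (simp add: N_def D_def card_bits)
  have "\<exists>\<omega>. 8 / 9 * real (card I) \<le> real (card {xi \<in> I. P xi \<omega>})"
    using alg row_in_row_streams finI unfolding P_def window_def
    by (intro exists_coins_many_events) (auto simp: sliding_window_covariance_def)
  then obtain \<omega> where \<omega>: "8 / 9 * real (card I) \<le> real (card {xi \<in> I. P xi \<omega>})" by auto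
  have "card I = card {xi \<in> I. P xi \<omega>} + card {xi \<in> I. \<not> P xi \<omega>}"
    using finI by (subst card_Un_disjoint[symmetric]) (auto intro!: arg_cong[where f = card])
  with \<omega> have fail: "real (card {xi \<in> I. \<not> P xi \<omega>}) \<le> 2 ^ N * real m / 9"
    using cardI by simp
  have "(\<Sum>x\<in>Pow bits. real (card (sym_diff x (decoded alg \<omega> x)))) \<le>
    (\<Sum>x\<in>Pow bits. \<Sum>i<m. D / 72 + (if P (x, i) \<omega> then 0 else D))"
  proof (rule sum_mono)
    fix x assume "x \<in> Pow bits"
    then have x: "x \<subseteq> bits" by simp
    have "sym_diff x (decoded alg \<omega> x) \<subseteq> (\<Union>i<m. errors alg \<omega> x i)"
      using x by (auto simp: errors_def decoded_def bits_def less_mult_imp_div_less)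
    moreover have "finite (errors alg \<omega> x i)" for i
      using finite_subset[OF errors_subset[OF x]] by blast
    ultimately have "card (sym_diff x (decoded alg \<omega> x)) \<le> card (\<Union>i<m. errors alg \<omega> x i)"
      by (intro card_mono) auto
    also have "\<dots> \<le> (\<Sum>i<m. card (errors alg \<omega> x i))" by (rule card_UN_le) simp
    finally have "real (card (sym_diff x (decoded alg \<omega> x))) \<le> (\<Sum>i<m. real (card (errors alg \<omega> x i)))"
      by (simp flip: of_nat_sum)
    also have "\<dots> \<le> (\<Sum>i<m. D / 72 + (if P (x, i) \<omega> then 0 else D))"
    proof (rule sum_mono)
      fix i assume "i \<in> {..<m}"
      moreover have "real (card (errors alg \<omega> x i)) \<le> D"
        unfolding D_def by (intro of_nat_mono card_errors_le[OF x])
      moreover have "0 \<le> D" by (simp add: D_def)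
      ultimately show "real (card (errors alg \<omega> x i)) \<le> D / 72 + (if P (x, i) \<omega> then 0 else D)"
        using card_errors_success[OF x, of i alg \<omega>] unfolding D_def[symmetric] P_def by auto
    qed
    finally show "real (card (sym_diff x (decoded alg \<omega> x))) \<le> \<dots>" .
  qed
  also have "\<dots> = (\<Sum>xi\<in>I. D / 72 + (if P xi \<omega> then 0 else D))"
    by (simp add: I_def sum.cartesian_product)
  also have "\<dots> = real (card I) * (D / 72) + real (card {xi \<in> I. \<not> P xi \<omega>}) * D"
    using finI by (simp add: sum.distrib sum.If_cases Int_def)
  \<comment> \<open>Failed queries may lose a whole block of \<open>D\<close> bits, successful ones
    at most \<open>D / 72\<close>; the rates add up as \<open>1/9 + 1/72 = 1/8\<close>.\<close>
  also have "\<dots> \<le> 2 ^ N * real m * (D / 72) + 2 ^ N * real m / 9 * D"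
    unfolding cardI by (intro add_left_mono mult_right_mono fail) (simp add: D_def)
  also have "\<dots> = 2 ^ N * (real N / 8)" by (simp add: N field_simps)
  finally have err: "(\<Sum>x\<in>Pow bits. real (card (sym_diff x (decoded alg \<omega> x)))) \<le> 2 ^ N * (real N / 8)" .

  have "card (decoded alg \<omega> ` Pow bits) < 2 ^ Suc s"
  proof (rule card_image_factor_le)
    show "length (memory_at alg \<omega> (row x) (m * d)) \<le> s" for x
      using space row_in_row_streams by (auto simp: uses_space_def)
    fix x y assume eq: "memory_at alg \<omega> (row x) (m * d) = memory_at alg \<omega> (row y) (m * d)"
    \<comment> \<open>From time \<open>m * d\<close> on every stream consists of zero rows, so one
      memory state determines the answers to all queries.\<close>
    have "output_at alg \<omega> (row x) (W + t) = output_at alg \<omega> (row y) (W + t)" for t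
      using memory_at_cong[OF eq, of "W + t"] md_le by (simp add: output_at_def row_def)
    then show "decoded alg \<omega> x = decoded alg \<omega> y" by (simp add: decoded_def)
  qed
  from lossy_compression_bound[OF finite_bits _ this] err show ?thesis
    by (auto simp: N_def card_bits decoded_def)
qed

end

section \<open>Choice of parameters\<close>

lemma nat_floor_bounds:
  assumes "1 \<le> (a::real)"
  shows "real (nat \<lfloor>a\<rfloor>) \<le> a" "a / 2 \<le> real (nat \<lfloor>a\<rfloor>)" "0 < nat \<lfloor>a\<rfloor>"
proof -
  have "1 \<le> \<lfloor>a\<rfloor>" using assms by simp
  then show "real (nat \<lfloor>a\<rfloor>) \<le> a" "a / 2 \<le> real (nat \<lfloor>a\<rfloor>)" "0 < nat \<lfloor>a\<rfloor>"
    by (simp_all, linarith+)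
qed

theorem mainTheorem12:
  shows "\<exists>c > 0. \<exists>\<epsilon>\<^sub>0 > 0. \<exists>C K.
    \<forall>(n::nat) (\<epsilon>::real) (W::nat) (E::real set) (alg::streaming_algorithm) (s::nat).
      1 \<le> n \<longrightarrow> 0 < \<epsilon> \<longrightarrow> \<epsilon> \<le> \<epsilon>\<^sub>0 \<longrightarrow>
      W = nat \<lceil>1 / (72\<^sup>2 * \<epsilon>\<^sup>2) * log 2 (real n)\<rceil> \<longrightarrow>
      admissible_entries C K n \<epsilon> E \<longrightarrow>
      sliding_window_covariance n W E \<epsilon> (8 / 9) alg \<longrightarrow>
      uses_space n E alg s \<longrightarrow>
      c * (real n / \<epsilon>\<^sup>2 * log 2 (real n)) \<le> real s"
proof -
  \<comment> \<open>\<open>\<epsilon> \<le> 1 / 192\<close> ensures \<open>1 \<le> a\<close> below,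
    hence \<open>d > 0\<close>. \<open>K = 1\<close> yields \<open>2 * d \<le> n\<close>, and
    \<open>C = 2\<close> suffices because \<open>2 ^ (m - 1)\<close> and \<open>h\<close> are both
    at most \<open>n\<close>.\<close>
  have main: "1 / (64 * 192\<^sup>2) * (real n / \<epsilon>\<^sup>2 * log 2 (real n)) \<le> real s"
    if n: "1 \<le> n" and \<epsilon>: "0 < \<epsilon>" "\<epsilon> \<le> 1 / 192"
      and W: "W = nat \<lceil>1 / (72\<^sup>2 * \<epsilon>\<^sup>2) * log 2 (real n)\<rceil>"
      and adm: "admissible_entries 2 1 n \<epsilon> E"
      and alg: "sliding_window_covariance n W E \<epsilon> (8 / 9) alg"
      and space: "uses_space n E alg s"
    for n W s :: nat and \<epsilon> E alg
  \<comment> \<open>For \<open>n = 1\<close> the logarithm vanishes and the bound is trivial; for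
    larger \<open>n\<close> with all reals allowed, no space bound can exist.\<close>
  proof (cases "n = 1 \<or> E = UNIV")
    case True
    show ?thesis
    proof (cases "n = 1")
      case False
      with n have "1 / (72\<^sup>2 * \<epsilon>\<^sup>2) * log 2 (real n) > 0"
        using \<epsilon> by (intro mult_pos_pos) auto
      then have "1 \<le> W" unfolding W by linarith
      then have False
        using no_bounded_space_real_entries[of n W \<epsilon> alg s] n \<epsilon> alg space True False by auto
      then show ?thesis ..
    qed simp
  next
    case False
    define L where "L = log 2 (real n)"
    define a where "a = 1 / (192\<^sup>2 * \<epsilon>\<^sup>2)"
    define m where "m = nat \<lfloor>L\<rfloor>"
    define d where "d = nat \<lfloor>a\<rfloor>"
    define h where "h = nat \<lceil>sqrt (real n)\<rceil>"
    have n2: "2 \<le> n" using n False by simp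
    have inv: "1 / \<epsilon>\<^sup>2 \<le> real n"
      and ents: "{real_of_int z | z. \<bar>z\<bar> \<le> int n ^ 2} \<subseteq> E"
      using adm False by (auto simp: admissible_entries_def)
    have "\<epsilon>\<^sup>2 \<le> (1 / 192)\<^sup>2" using \<epsilon> by (intro power_mono) auto
    then have a1: "1 \<le> a" using \<epsilon> by (simp add: a_def field_simps power2_eq_square)
    have an: "192\<^sup>2 * a \<le> real n" using inv by (simp add: a_def)
    have L1: "1 \<le> L" using n2 by (simp add: L_def le_log_iff)
    have d: "real d \<le> a" "a / 2 \<le> real d" "0 < d" using nat_floor_bounds[OF a1] by (simp_all add: d_def)
    have m: "real m \<le> L" "L / 2 \<le> real m" "0 < m" using nat_floor_bounds[OF L1] by (simp_all add: m_def)
    have dn: "2 * d \<le> n" using d(1) a1 an by (simp flip: of_nat_le_iff)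
    have sq1: "1 \<le> sqrt (real n)" using n by simp
    have h: "sqrt (real n) \<le> real h" "real h \<le> 2 * sqrt (real n)"
      using sq1 unfolding h_def by linarith+
    have "sqrt (real n) \<le> real n"
      using n by (intro real_le_lsqrt) (simp_all add: power2_eq_square)
    then have hn: "h \<le> n" unfolding h_def by (simp add: ceiling_le_iff)
    have "2 ^ m = 2 powr real m" by (simp add: powr_realpow)
    also have "\<dots> \<le> 2 powr L" using m by simp
    also have "\<dots> = real n" using n by (simp add: L_def)
    finally have pm: "2 ^ m \<le> n" by (simp flip: of_nat_le_iff)
    interpret hard_streams n m d h W \<epsilon> E
    proof
      show "n \<le> h\<^sup>2"
        using power_mono[OF h(1), of 2] by (simp flip: of_nat_le_iff)
      have "real (h\<^sup>2) \<le> real (4 * n)"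
        using power_mono[OF h(2), of 2] by (simp add: power_mult_distrib)
      then show "h\<^sup>2 \<le> 4 * n" by (simp only: of_nat_le_iff)
      have "real (m * d) \<le> L * a" using m d L1 unfolding of_nat_mult by (intro mult_mono) auto
      \<comment> \<open>The blocks fit into the prescribed window because
        \<open>72 \<le> 192\<close>.\<close>
      also have "\<dots> \<le> 1 / (72\<^sup>2 * \<epsilon>\<^sup>2) * L"
        using \<epsilon> L1 by (simp add: a_def field_simps)
      also have "\<dots> \<le> real W" unfolding W L_def by linarith
      finally show "m * d \<le> W" by (simp only: of_nat_le_iff)
      have "192\<^sup>2 * \<epsilon>\<^sup>2 * real d \<le> 192\<^sup>2 * \<epsilon>\<^sup>2 * a"
        by (intro mult_left_mono d(1)) simp
      also have "\<dots> = 1" using \<epsilon> by (simp add: a_def)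
      finally show "192\<^sup>2 * \<epsilon>\<^sup>2 * real d \<le> 1" .
      have "(2::nat) ^ (m - 1) \<le> 2 ^ m" by (intro power_increasing) auto
      then have "2 ^ (m - 1) \<le> n" using pm by (rule order.trans)
      then have "2 ^ (m - 1) * h \<le> n\<^sup>2"
        unfolding power2_eq_square using hn by (rule mult_mono) simp_all
      then have "int (2 ^ (m - 1) * h) \<le> int (n\<^sup>2)" by (simp only: of_nat_le_iff)
      then have "2 ^ (m - 1) * int h \<le> int n ^ 2" by simp
      then show "{real_of_int z | z. \<bar>z\<bar> \<le> 2 ^ (m - 1) * int h} \<subseteq> E"
        by (intro order.trans[OF _ ents] subsetI) (blast intro: order.trans)
    qed (fact d(3) dn \<epsilon>(1))+
    \<comment> \<open>Rounding down \<open>L\<close> and \<open>a\<close> and giving up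
      \<open>d\<close> columns each cost at most a factor 2.\<close>
    have "L / 2 * (a / 2) * (real n / 2) \<le> real m * real d * real (n - d)"
      using m d dn L1 a1 by (intro mult_mono) auto
    then have N: "L * a * real n / 8 \<le> real (m * d * (n - d))" by simp
    have "1 * 1 * (192\<^sup>2 * 1) \<le> L * a * real n"
      using L1 a1 an by (intro mult_mono) auto
    \<comment> \<open>This absorbs the 1 in \<open>Suc s\<close> at the price of a further factor 2,
      whence the constant 64.\<close>
    then have "64 \<le> L * a * real n" by simp
    then have "L * a * real n / 64 \<le> real s"
      using space_lower_bound[OF alg space] N unfolding of_nat_Suc by linarith
    moreover have "1 / (64 * 192\<^sup>2) * (real n / \<epsilon>\<^sup>2 * L) = L * a * real n / 64"
      by (simp add: a_def)
    ultimately show ?thesis by (simp only: L_def)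
  qed
  have "(0::real) < 1 / (64 * 192\<^sup>2)" "(0::real) < 1 / 192" by simp_all
  then show ?thesis
    by (intro exI[of _ "1 / (64 * 192\<^sup>2)"] exI[of _ "1 / 192"] exI[of _ "2::nat"] exI[of _ "1::real"] conjI allI impI)
      (assumption | rule main)+
qed

end
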